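(* For any finite set $X$, let $\xi:\widetilde{\mathbb{D}}_X\otimes(\mathbb{D}\otimes\mathbb{D})_X\to\widetilde{\mathbb{D}}_X\otimes(\mathbb{D}\otimes\mathbb{D})_X$ be the linear map defined by $$\xi\big((\mathcal{T},\widetilde{\mathcal{T}})\otimes(\mathcal{T}_1,Z)\otimes(\mathcal{T}_2,W)\big)=(\mathcal{T}_{|Z}\mathcal{T}_{|X\setminus Z},\ \widetilde{\mathcal{T}}_{|Z}\widetilde{\mathcal{T}}_{|X\setminus Z})\otimes(\mathcal{T}_1,Z)\otimes(\mathcal{T}_2,W),$$ where $(\mathcal{T}_1,Z)\in\mathbb{D}_{X_1}$, $(\mathcal{T}_2,W)\in\mathbb{D}_{X_2}$, $X_1\sqcup X_2=X$. Then, as maps $\mathbb{D}_X\to\widetilde{\mathbb{D}}_X\otimes(\mathbb{D}\otimes\mathbb{D})_X$, $$\xi\circ(\mathrm{id}\otimes\Delta)\circ\Phi=m^{1,3}\circ(\Phi\otimes\Phi)\circ\Delta.$$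
   Context: $\mathbf{k}$ is a field. A topology on a finite set $X$ is identified with its family $\mathcal{T}$ of open subsets. It corresponds bijectively to a quasi-order: $x\le_{\mathcal{T}}y$ iff every open subset containing $x$ contains $y$ (open subsets are the upper ideals). Put $x\sim_{\mathcal{T}}y$ iff $x\le_{\mathcal{T}}y$ and $y\le_{\mathcal{T}}x$. For $Y\subset X$, $\mathcal{T}_{|Y}=\{Z\cap Y:Z\in\mathcal{T}\}$. For topologies $\mathcal{T}_i$ on $X_i$ ($i=1,2$), $\mathcal{T}_1\mathcal{T}_2$ is the disjoint union topology on $X_1\sqcup X_2$. For topologies on the same set $X$, $\mathcal{T}'$ is finer than $\mathcal{T}$, written $\mathcal{T}'\prec\mathcal{T}$, if every $\mathcal{T}$-open set is $\mathcal{T}'$-open (equality is allowed). If $\mathcal{T}'\prec\mathcal{T}$, the quotient $\mathcal{T}/\mathcal{T}'$ is the topology on $X$ whose quasi-order is the transitive closure of the relation: $x\le_{\mathcal{T}}y$ or $y\le_{\mathcal{T}'}x$. The topology $\mathcal{T}'$ is $\mathcal{T}$-admissible, written $\mathcal{T}'\preccurlyeq_{\mathrm{ad}}\mathcal{T}$, if: (i) $\mathcal{T}'\prec\mathcal{T}$; (ii) $\mathcal{T}'_{|Y}=\mathcal{T}_{|Y}$ for every $Y\subset X$ connected for $\mathcal{T}'$; (iii) for all $x,y\in X$, $x\sim_{\mathcal{T}/\mathcal{T}'}y\iff x\sim_{\mathcal{T}'/\mathcal{T}'}y$. For a topology $\mathcal{T}$ on $X$, $D_{X,\mathcal{T}}$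 denotes the finest $\mathcal{T}$-admissible topology: its connected components are the equivalence classes of $\sim_{\mathcal{T}}$, and its restriction to each of them is the coarse topology. For $Y\subset X$, $D_{Y,\mathcal{T}}$ means $D_{Y,\mathcal{T}_{|Y}}$. $\mathbb{D}_X$ is the $\mathbf{k}$-vector space with basis the pairs $(\mathcal{T},Y)$ with $\mathcal{T}$ a topology on $X$ and $Y\in\mathcal{T}$. $\widetilde{\mathbb{D}}_X$ is the $\mathbf{k}$-vector space with basis the pairs $(\mathcal{T},\mathcal{T}')$ of topologies on $X$ with $\mathcal{T}'\preccurlyeq_{\mathrm{ad}}\mathcal{T}$. Put $(\mathbb{D}\otimes\mathbb{D})_X=\bigoplus_{X_1\sqcup X_2=X}\mathbb{D}_{X_1}\otimes\mathbb{D}_{X_2}$. The maps are: $\Delta:\mathbb{D}_X\to(\mathbb{D}\otimes\mathbb{D})_X$, $\Delta(\mathcal{T},Y)=\sum_{Z\in\mathcal{T}_{|Y}}(\mathcal{T}_{|Z},Z)\otimes(\mathcal{T}_{|X\setminus Z},Y\setminus Z)$; $\Phi:\mathbb{D}_X\to\widetilde{\mathbb{D}}_X\otimes\mathbb{D}_X$, $\Phi(\mathcal{T},Y)=\sum_{\mathcal{T}'}(\mathcal{T},\mathcal{T}')\otimes(\mathcal{T}/\mathcal{T}',Y)$, the sum being over topologies $\mathcal{T}'$ on $X$ with $\mathcal{T}'\preccurlyeq_{\mathrm{ad}}\mathcal{T}$, $Y\in\mathcal{T}/\mathcal{T}'$ and $\mathcal{T}'_{|X\setminus Y}=D_{X\setminus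 Y,\mathcal{T}'}$; and $m^{1,3}:\bigoplus_{Y\subset X}\widetilde{\mathbb{D}}_Y\otimes\mathbb{D}_Y\otimes\widetilde{\mathbb{D}}_{X\setminus Y}\otimes\mathbb{D}_{X\setminus Y}\to\widetilde{\mathbb{D}}_X\otimes(\mathbb{D}\otimes\mathbb{D})_X$, $a_1\otimes b_1\otimes a_2\otimes b_2\mapsto a_1a_2\otimes b_1\otimes b_2$, where the product of $\widetilde{\mathbb{D}}$ is $(\mathcal{T}_1,\mathcal{T}_1')(\mathcal{T}_2,\mathcal{T}_2')=(\mathcal{T}_1\mathcal{T}_2,\mathcal{T}_1'\mathcal{T}_2')$. *)

theory Defs
  imports "HOL-Analysis.Abstract_Topology_2" "HOL-Library.Poly_Mapping"
begin

section \<open>Finite topologies and quasi-orders\<close>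

text \<open>A topology on \<open>X\<close> is a value \<open>T :: 'a topology\<close> with \<open>topspace T = X\<close>; its family of
  open sets is \<open>Collect (openin T)\<close> and \<open>T\<^sub>|\<^sub>Y\<close> is \<open>subtopology T Y\<close>.\<close>

definition le_top :: "'a topology \<Rightarrow> 'a \<Rightarrow> 'a \<Rightarrow> bool" where
  "le_top T x y \<longleftrightarrow> x \<in> topspace T \<and> y \<in> topspace T \<and> (\<forall>U. openin T U \<longrightarrow> x \<in> U \<longrightarrow> y \<in> U)"

definition equiv_top :: "'a topology \<Rightarrow> 'a \<Rightarrow> 'a \<Rightarrow> bool" where
  "equiv_top T x y \<longleftrightarrow> le_top T x y \<and> le_top T y x"

definition finer :: "'a topology \<Rightarrow> 'a topology \<Rightarrow> bool" where
  "finer T' T \<longleftrightarrow> topspace T' = topspace T \<and> (\<forall>U. openin T U \<longrightarrow> openin T' U)"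

text \<open>The topology on \<open>X\<close> attached to a relation \<open>R\<close>: its open sets are the upper ideals of \<open>R\<close>.\<close>

definition upper_topology :: "'a set \<Rightarrow> ('a \<Rightarrow> 'a \<Rightarrow> bool) \<Rightarrow> 'a topology" where
  "upper_topology X R = topology (\<lambda>U. U \<subseteq> X \<and> (\<forall>x\<in>U. \<forall>y\<in>X. R x y \<longrightarrow> y \<in> U))"

definition quot_top :: "'a topology \<Rightarrow> 'a topology \<Rightarrow> 'a topology" where
  "quot_top T T' = upper_topology (topspace T) ((\<lambda>x y. le_top T x y \<or> le_top T' y x)\<^sup>+\<^sup>+)"

text \<open>Internal disjoint union; only used when \<open>topspace T1\<close> and \<open>topspace T2\<close> are disjoint.\<close>

definition disj_union :: "'a topology \<Rightarrow> 'a topology \<Rightarrow> 'a topology" where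
  "disj_union T1 T2 = topology (\<lambda>U. U \<subseteq> topspace T1 \<union> topspace T2 \<and>
      openin T1 (U \<inter> topspace T1) \<and> openin T2 (U \<inter> topspace T2))"

definition admissible :: "'a topology \<Rightarrow> 'a topology \<Rightarrow> bool" where
  "admissible T' T \<longleftrightarrow>
     finer T' T \<and>
     (\<forall>Y. connectedin T' Y \<longrightarrow> subtopology T' Y = subtopology T Y) \<and>
     (\<forall>x\<in>topspace T. \<forall>y\<in>topspace T.
        equiv_top (quot_top T T') x y \<longleftrightarrow> equiv_top (quot_top T' T') x y)"

definition finest_admissible :: "'a topology \<Rightarrow> 'a topology" where
  "finest_admissible T = (THE D. admissible D T \<and> (\<forall>T'. admissible T' T \<longrightarrow> finer D T'))"


section \<open>Free vector spaces, linear extension and tensor products\<close>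

text \<open>The vector space with basis \<open>B :: 'b set\<close> is the set \<open>free_space B\<close> of finitely supported
  functions \<open>'b \<Rightarrow>\<^sub>0 'k\<close> supported in \<open>B\<close>. The tensor product of the spaces with bases \<open>B\<close> and \<open>C\<close>
  is the space with basis \<open>B \<times> C\<close>, the tensor of two vectors being \<open>tensor\<close>.\<close>

definition free_space :: "'b set \<Rightarrow> ('b \<Rightarrow>\<^sub>0 'k::field) set" where
  "free_space B = {v. Poly_Mapping.keys v \<subseteq> B}"

definition scale :: "'k::field \<Rightarrow> ('b \<Rightarrow>\<^sub>0 'k) \<Rightarrow> ('b \<Rightarrow>\<^sub>0 'k)" where
  "scale c v = Poly_Mapping.map ((*) c) v"

definition basis_vec :: "'b \<Rightarrow> ('b \<Rightarrow>\<^sub>0 'k::field)" where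
  "basis_vec b = Poly_Mapping.single b 1"

definition lin_ext :: "('b \<Rightarrow> ('c \<Rightarrow>\<^sub>0 'k::field)) \<Rightarrow> ('b \<Rightarrow>\<^sub>0 'k) \<Rightarrow> ('c \<Rightarrow>\<^sub>0 'k)" where
  "lin_ext f v = (\<Sum>b\<in>Poly_Mapping.keys v. scale (Poly_Mapping.lookup v b) (f b))"

definition tensor :: "('b \<Rightarrow>\<^sub>0 'k::field) \<Rightarrow> ('c \<Rightarrow>\<^sub>0 'k) \<Rightarrow> ('b \<times> 'c \<Rightarrow>\<^sub>0 'k)" where
  "tensor v w = lin_ext (\<lambda>b. lin_ext (\<lambda>c. basis_vec (b, c)) w) v"

definition tensor_map :: "(('b \<Rightarrow>\<^sub>0 'k::field) \<Rightarrow> ('d \<Rightarrow>\<^sub>0 'k)) \<Rightarrow> (('c \<Rightarrow>\<^sub>0 'k) \<Rightarrow> ('e \<Rightarrow>\<^sub>0 'k)) \<Rightarrow>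
    ('b \<times> 'c \<Rightarrow>\<^sub>0 'k) \<Rightarrow> ('d \<times> 'e \<Rightarrow>\<^sub>0 'k)" where
  "tensor_map f g = lin_ext (\<lambda>(b, c). tensor (f (basis_vec b)) (g (basis_vec c)))"


section \<open>The species and the maps\<close>

definition D_basis :: "'a set \<Rightarrow> ('a topology \<times> 'a set) set" where
  "D_basis X = {(T, Y). topspace T = X \<and> openin T Y}"

definition Dt_basis :: "'a set \<Rightarrow> ('a topology \<times> 'a topology) set" where
  "Dt_basis X = {(T, T'). topspace T = X \<and> admissible T' T}"

text \<open>The direct sums over decompositions of \<open>X\<close> become unions of bases; these unions are
  disjoint, since the underlying sets can be read off from the topologies.\<close>

definition DD_basis :: "'a set \<Rightarrow> (('a topology \<times> 'a set) \<times> ('a topology \<times> 'a set)) set" where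
  "DD_basis X = (\<Union>X1\<in>Pow X. D_basis X1 \<times> D_basis (X - X1))"

definition DtDDtD_basis :: "'a set \<Rightarrow> ((('a topology \<times> 'a topology) \<times> ('a topology \<times> 'a set)) \<times>
    (('a topology \<times> 'a topology) \<times> ('a topology \<times> 'a set))) set" where
  "DtDDtD_basis X =
     (\<Union>Y\<in>Pow X. (Dt_basis Y \<times> D_basis Y) \<times> (Dt_basis (X - Y) \<times> D_basis (X - Y)))"

text \<open>For \<open>T\<close> on a finite set, the index sets of the sums in \<open>\<Delta>\<close> and \<open>\<Phi>\<close> are finite.\<close>

definition \<Delta> :: "('a topology \<times> 'a set \<Rightarrow>\<^sub>0 'k::field) \<Rightarrow>
    (('a topology \<times> 'a set) \<times> ('a topology \<times> 'a set) \<Rightarrow>\<^sub>0 'k)" where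
  "\<Delta> = lin_ext (\<lambda>(T, Y). \<Sum>Z | openin (subtopology T Y) Z.
     tensor (basis_vec (subtopology T Z, Z))
            (basis_vec (subtopology T (topspace T - Z), Y - Z)))"

definition \<Phi> :: "('a topology \<times> 'a set \<Rightarrow>\<^sub>0 'k::field) \<Rightarrow>
    (('a topology \<times> 'a topology) \<times> ('a topology \<times> 'a set) \<Rightarrow>\<^sub>0 'k)" where
  "\<Phi> = lin_ext (\<lambda>(T, Y).
     \<Sum>T' | admissible T' T \<and> openin (quot_top T T') Y \<and>
         subtopology T' (topspace T - Y) = finest_admissible (subtopology T' (topspace T - Y)).
     tensor (basis_vec (T, T')) (basis_vec (quot_top T T', Y)))"

fun Dt_mult :: "'a topology \<times> 'a topology \<Rightarrow> 'a topology \<times> 'a topology \<Rightarrow>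
    'a topology \<times> 'a topology" where
  "Dt_mult (T1, T1') (T2, T2') = (disj_union T1 T2, disj_union T1' T2')"

definition m13 :: "((('a topology \<times> 'a topology) \<times> ('a topology \<times> 'a set)) \<times>
      (('a topology \<times> 'a topology) \<times> ('a topology \<times> 'a set)) \<Rightarrow>\<^sub>0 'k::field) \<Rightarrow>
    (('a topology \<times> 'a topology) \<times>
      (('a topology \<times> 'a set) \<times> ('a topology \<times> 'a set)) \<Rightarrow>\<^sub>0 'k)" where
  "m13 = lin_ext (\<lambda>((a1, b1), (a2, b2)).
     tensor (basis_vec (Dt_mult a1 a2)) (tensor (basis_vec b1) (basis_vec b2)))"

definition \<xi> :: "(('a topology \<times> 'a topology) \<times>
      (('a topology \<times> 'a set) \<times> ('a topology \<times> 'a set)) \<Rightarrow>\<^sub>0 'k::field) \<Rightarrow>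
    (('a topology \<times> 'a topology) \<times>
      (('a topology \<times> 'a set) \<times> ('a topology \<times> 'a set)) \<Rightarrow>\<^sub>0 'k)" where
  "\<xi> = lin_ext (\<lambda>((T, T'), ((T1, Z), (T2, W))).
     tensor (basis_vec
         (disj_union (subtopology T Z) (subtopology T (topspace T - Z)),
          disj_union (subtopology T' Z) (subtopology T' (topspace T - Z))))
       (tensor (basis_vec (T1, Z)) (basis_vec (T2, W))))"

section \<open>Basic facts\<close>

subsection \<open>The topologies defined above\<close>

lemma openin_upper_topology:
  "openin (upper_topology X R) U \<longleftrightarrow> U \<subseteq> X \<and> (\<forall>x\<in>U. \<forall>y\<in>X. R x y \<longrightarrow> y \<in> U)"
proof -
  have "istopology (\<lambda>U. U \<subseteq> X \<and> (\<forall>x\<in>U. \<forall>y\<in>X. R x y \<longrightarrow> y \<in> U))"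
    unfolding istopology_def by blast
  then show ?thesis
    by (simp add: upper_topology_def topology_inverse')
qed

lemma topspace_upper_topology [simp]: "topspace (upper_topology X R) = X"
  unfolding topspace_def openin_upper_topology by blast

lemma le_top_upper_topology:
  assumes "reflp_on X R" "transp R"
  shows "le_top (upper_topology X R) x y \<longleftrightarrow> x \<in> X \<and> y \<in> X \<and> R x y"
proof
  assume *: "le_top (upper_topology X R) x y"
  then have "x \<in> X" "y \<in> X" by (auto simp: le_top_def)
  moreover have "openin (upper_topology X R) {z\<in>X. R x z}"
    using assms(2) by (auto simp: openin_upper_topology dest: transpD)
  ultimately show "x \<in> X \<and> y \<in> X \<and> R x y"
    using * assms(1) by (auto simp: le_top_def reflp_on_def)
qed (auto simp: le_top_def openin_upper_topology)

lemma openin_disj_union: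
  "openin (disj_union T1 T2) U \<longleftrightarrow> U \<subseteq> topspace T1 \<union> topspace T2 \<and>
     openin T1 (U \<inter> topspace T1) \<and> openin T2 (U \<inter> topspace T2)"
proof -
  have 1: "openin T ((U \<inter> V) \<inter> topspace T)"
    if "openin T (U \<inter> topspace T)" "openin T (V \<inter> topspace T)" for T :: "'a topology" and U V
    using openin_Int[OF that] by (simp add: Int_ac)
  have 2: "openin T (\<Union>\<K> \<inter> topspace T)" if "\<And>K. K \<in> \<K> \<Longrightarrow> openin T (K \<inter> topspace T)"
    for T :: "'a topology" and \<K>
  proof -
    have "openin T (\<Union>((\<lambda>K. K \<inter> topspace T) ` \<K>))" using that by (intro openin_Union) auto
    then show ?thesis by (simp only: Int_Union2)
  qed
  have "istopology (\<lambda>U. U \<subseteq> topspace T1 \<union> topspace T2 \<and>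
      openin T1 (U \<inter> topspace T1) \<and> openin T2 (U \<inter> topspace T2))"
    unfolding istopology_def
  proof (intro conjI allI impI; (elim conjE)?)
    fix \<K> assume "\<forall>K\<in>\<K>. K \<subseteq> topspace T1 \<union> topspace T2 \<and>
        openin T1 (K \<inter> topspace T1) \<and> openin T2 (K \<inter> topspace T2)"
    then show "\<Union>\<K> \<subseteq> topspace T1 \<union> topspace T2"
      "openin T1 (\<Union>\<K> \<inter> topspace T1)" "openin T2 (\<Union>\<K> \<inter> topspace T2)"
      by (intro Union_least 2; blast)+
  qed (simp_all only: 1 le_infI1)
  then show ?thesis
    by (simp add: disj_union_def topology_inverse')
qed

lemma topspace_disj_union [simp]: "topspace (disj_union T1 T2) = topspace T1 \<union> topspace T2"
proof
  show "topspace (disj_union T1 T2) \<subseteq> topspace T1 \<union> topspace T2"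
    using openin_topspace[of "disj_union T1 T2"] by (simp only: openin_disj_union)
  have "openin (disj_union T1 T2) (topspace T1 \<union> topspace T2)"
    by (simp add: openin_disj_union Int_absorb1)
  then show "topspace T1 \<union> topspace T2 \<subseteq> topspace (disj_union T1 T2)"
    by (rule openin_subset)
qed

lemma le_top_refl: "x \<in> topspace T \<Longrightarrow> le_top T x x"
  by (simp add: le_top_def)

lemma le_top_trans: "le_top T x y \<Longrightarrow> le_top T y z \<Longrightarrow> le_top T x z"
  by (simp add: le_top_def)

lemma le_top_in: "le_top T x y \<Longrightarrow> x \<in> topspace T \<and> y \<in> topspace T"
  by (simp add: le_top_def)

lemma finer_le_top: "finer T' T \<Longrightarrow> le_top T' x y \<Longrightarrow> le_top T x y"
  by (simp add: finer_def le_top_def)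

lemma le_top_subtopology: "le_top (subtopology T Z) x y \<longleftrightarrow> x \<in> Z \<and> y \<in> Z \<and> le_top T x y"
  by (auto simp: le_top_def openin_subtopology)

lemma tranclp_mono_rule:
  assumes "r\<^sup>+\<^sup>+ x y" "\<And>x y. r x y \<Longrightarrow> s x y" shows "s\<^sup>+\<^sup>+ x y"
  using assms(1) by induction (auto intro: assms(2) tranclp.trancl_into_trancl)

lemma topspace_quot_top [simp]: "topspace (quot_top T T') = topspace T"
  by (simp add: quot_top_def)

lemma le_top_quot_top:
  assumes "topspace T' = topspace T"
  shows "le_top (quot_top T T') x y \<longleftrightarrow> (\<lambda>x y. le_top T x y \<or> le_top T' y x)\<^sup>+\<^sup>+ x y"
proof -
  let ?R = "\<lambda>x y. le_top T x y \<or> le_top T' y x"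
  have in_X: "x \<in> topspace T \<and> y \<in> topspace T" if "?R\<^sup>+\<^sup>+ x y" for x y
    using that by induction (auto simp: le_top_def assms)
  have "reflp_on (topspace T) ?R\<^sup>+\<^sup>+" by (auto intro!: reflp_onI simp: le_top_refl)
  then show ?thesis
    unfolding quot_top_def using in_X
    by (subst le_top_upper_topology) (auto intro!: transpI intro: tranclp_trans)
qed

lemma le_top_imp_connected_component: "connected_component_of T x y" if "le_top T x y"
proof -
  have "connectedin T {x, y}"
    using that unfolding connectedin le_top_def by fast
  then show ?thesis unfolding connected_component_of_def by blast
qed

lemma le_quot_self_imp_connected_component:
  assumes "le_top (quot_top T T) x y" shows "connected_component_of T x y"
proof -
  from assms have "(\<lambda>x y. le_top T x y \<or> le_top T y x)\<^sup>+\<^sup>+ x y" by (simp add: le_top_quot_top)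
  then show ?thesis
    by induction (metis le_top_imp_connected_component connected_component_of_sym
        connected_component_of_trans)+
qed

lemma admissible_le_top:
  assumes adm: "admissible T' T" and eq: "equiv_top (quot_top T T') x y" and le: "le_top T x y"
  shows "le_top T' x y"
proof -
  have "equiv_top (quot_top T' T') x y"
    using adm eq le le_top_in[OF le] by (simp add: admissible_def)
  then obtain C where C: "connectedin T' C" "x \<in> C" "y \<in> C"
    using le_quot_self_imp_connected_component[of T' x y]
    by (auto simp: equiv_top_def connected_component_of_def)
  then have "subtopology T' C = subtopology T C" using adm by (simp add: admissible_def)
  moreover have "le_top (subtopology T C) x y" using C le by (simp add: le_top_subtopology)
  ultimately show ?thesis by (metis le_top_subtopology)
qed

lemma quot_top_mono:
  assumes "finer T' T" and "le_top (quot_top T' T') x y"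
  shows "le_top (quot_top T T') x y"
proof -
  have "topspace T' = topspace T" using assms(1) by (simp add: finer_def)
  moreover have "(\<lambda>x y. le_top T x y \<or> le_top T' y x)\<^sup>+\<^sup>+ x y"
    using assms(2) unfolding le_top_quot_top[OF refl]
    by (rule tranclp_mono_rule) (use finer_le_top[OF assms(1)] in blast)
  ultimately show ?thesis by (simp add: le_top_quot_top)
qed


subsection \<open>The finest admissible topology\<close>

text \<open>The definite description in \<open>finest_admissible\<close> is proper, and its value is the topology
  whose connected components are the classes of \<open>equiv_top T\<close>, each with the coarse topology.\<close>

lemma admissible_equiv_top: "admissible (upper_topology (topspace T) (equiv_top T)) T"
  (is "admissible ?D T")
proof -
  let ?X = "topspace T"
  have le_D: "le_top ?D x y \<longleftrightarrow> equiv_top T x y" for x y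
    by (subst le_top_upper_topology)
      (auto simp: equiv_top_def reflp_on_def le_top_refl dest: le_top_in
        intro!: transpI intro: le_top_trans)
  have finer: "finer ?D T"
    unfolding finer_def
    by (auto simp: openin_upper_topology equiv_top_def le_top_def dest: openin_subset)
  have "subtopology ?D Y = subtopology T Y" if Y: "connectedin ?D Y" for Y
  proof -
    have YX: "Y \<subseteq> ?X" using connectedin_subset_topspace[OF Y] by simp
    have eq: "equiv_top T x y" if "x \<in> Y" "y \<in> Y" for x y
    proof (rule ccontr)
      assume "\<not> equiv_top T x y"
      let ?E1 = "{z\<in>?X. equiv_top T x z}" and ?E2 = "{z\<in>?X. \<not> equiv_top T x z}"
      have "openin ?D ?E1" "openin ?D ?E2"
        by (auto simp: openin_upper_topology equiv_top_def intro: le_top_trans)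
      moreover have "x \<in> ?E1 \<inter> Y" "y \<in> ?E2 \<inter> Y"
        using that YX \<open>\<not> equiv_top T x y\<close> by (auto simp: equiv_top_def le_top_refl)
      moreover have "Y \<subseteq> ?E1 \<union> ?E2" "?E1 \<inter> ?E2 \<inter> Y = {}" using YX by auto
      ultimately show False using Y unfolding connectedin by blast
    qed
    have "openin (subtopology S Y) U \<longleftrightarrow> U = {} \<or> U = Y"
      if S: "topspace S = ?X" "\<And>x y. x \<in> Y \<Longrightarrow> y \<in> Y \<Longrightarrow> le_top S x y" for S U
    proof
      assume "openin (subtopology S Y) U"
      then show "U = {} \<or> U = Y"
        using S(2) by (auto simp: openin_subtopology le_top_def)
    next
      assume "U = {} \<or> U = Y"
      moreover have "openin (subtopology S Y) Y"
        using S(1) YX openin_subtopology_self by (metis Int_absorb1 openin_topspace topspace_subtopology)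
      ultimately show "openin (subtopology S Y) U" by auto
    qed
    from this[of ?D] this[of T] show ?thesis
      using eq by (auto simp: topology_eq le_D) (auto simp: equiv_top_def)
  qed
  moreover have "equiv_top (quot_top T ?D) x y \<longleftrightarrow> equiv_top (quot_top ?D ?D) x y" for x y
  proof -
    have "le_top (quot_top T ?D) x y \<longleftrightarrow> le_top T x y" for x y
    proof -
      have "(\<lambda>x y. le_top T x y \<or> le_top ?D y x) = le_top T"
        by (auto simp: le_D equiv_top_def fun_eq_iff)
      moreover have "(le_top T)\<^sup>+\<^sup>+ x y \<longleftrightarrow> le_top T x y"
        by (auto elim: tranclp_induct intro: le_top_trans)
      ultimately show ?thesis by (simp add: le_top_quot_top)
    qed
    moreover have "le_top (quot_top ?D ?D) x y \<longleftrightarrow> equiv_top T x y" for x y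
    proof -
      have "(\<lambda>x y. le_top ?D x y \<or> le_top ?D y x) = equiv_top T"
        by (auto simp: le_D equiv_top_def fun_eq_iff)
      moreover have "equiv_top T x y" if "(equiv_top T)\<^sup>+\<^sup>+ x y"
        using that by induction (auto simp: equiv_top_def intro: le_top_trans)
      then have "(equiv_top T)\<^sup>+\<^sup>+ x y \<longleftrightarrow> equiv_top T x y" by blast
      ultimately show ?thesis by (simp add: le_top_quot_top)
    qed
    ultimately show ?thesis by (auto simp: equiv_top_def)
  qed
  ultimately show ?thesis using finer by (simp add: admissible_def)
qed

lemma finest_admissible_least:
  assumes "admissible T' T"
  shows "finer (upper_topology (topspace T) (equiv_top T)) T'"
proof -
  have top: "topspace T' = topspace T" using assms by (simp add: admissible_def finer_def)
  have "le_top T' x y" if "equiv_top T x y" for x y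
  proof (rule admissible_le_top[OF assms])
    show "equiv_top (quot_top T T') x y"
      using that by (auto simp: equiv_top_def le_top_quot_top[OF top])
  qed (use that in \<open>simp add: equiv_top_def\<close>)
  then show ?thesis
    unfolding finer_def openin_upper_topology
    using top openin_subset[of T'] by (auto simp: le_top_def)
qed

lemma finest_admissible_eq:
  "finest_admissible T = upper_topology (topspace T) (equiv_top T)"
  unfolding finest_admissible_def
proof (rule the_equality)
  fix D assume D: "admissible D T \<and> (\<forall>T'. admissible T' T \<longrightarrow> finer D T')"
  then have "finer D (upper_topology (topspace T) (equiv_top T))"
    using admissible_equiv_top by blast
  moreover have "finer (upper_topology (topspace T) (equiv_top T)) D"
    using D finest_admissible_least by blast
  ultimately show "D = upper_topology (topspace T) (equiv_top T)"
    by (auto simp: finer_def topology_eq)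
qed (use admissible_equiv_top finest_admissible_least in blast)


subsection \<open>Admissibility, restrictions and disjoint unions\<close>

lemma admissible_subtopology:
  assumes adm: "admissible T' T"
  shows "admissible (subtopology T' Z) (subtopology T Z)"
proof -
  have top: "topspace T' = topspace T" and fin: "finer T' T"
    and conn: "\<And>Y. connectedin T' Y \<Longrightarrow> subtopology T' Y = subtopology T Y"
    using adm by (auto simp: admissible_def finer_def)
  let ?S = "subtopology T Z" and ?S' = "subtopology T' Z"
  have topS: "topspace ?S' = topspace ?S" by (simp add: top)
  have finS: "finer ?S' ?S" using fin by (auto simp: finer_def openin_subtopology)
  have "subtopology ?S' Y = subtopology ?S Y" if "connectedin ?S' Y" for Y
    using that conn[of Y] by (simp add: connectedin_subtopology subtopology_subtopology Int_absorb1)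
  moreover have "equiv_top (quot_top ?S ?S') x y \<longleftrightarrow> equiv_top (quot_top ?S' ?S') x y" for x y
  proof
    assume "equiv_top (quot_top ?S' ?S') x y"
    then show "equiv_top (quot_top ?S ?S') x y"
      using quot_top_mono[OF finS] by (auto simp: equiv_top_def)
  next
    have big: "le_top (quot_top T T') u v" if "le_top (quot_top ?S ?S') u v" for u v
      using that unfolding le_top_quot_top[OF top] le_top_quot_top[OF topS]
      by (rule tranclp_mono_rule) (auto simp: le_top_subtopology)
    have *: "le_top (quot_top ?S' ?S') x y"
      if xy: "le_top (quot_top ?S ?S') x y" and yx: "le_top (quot_top ?S ?S') y x" for x y
    proof -
      let ?R = "\<lambda>x y. le_top ?S x y \<or> le_top ?S' y x"
      let ?R' = "\<lambda>x y. le_top ?S' x y \<or> le_top ?S' y x"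
      have step: "?R' u v" if "?R u v" "le_top (quot_top ?S ?S') v u" for u v
      proof -
        have "le_top (quot_top ?S ?S') u v" using that(1) by (auto simp: le_top_quot_top[OF topS])
        then have "equiv_top (quot_top T T') u v" using that(2) big by (simp add: equiv_top_def)
        then show ?thesis
          using that(1) admissible_le_top[OF adm] by (auto simp: le_top_subtopology)
      qed
      have "?R\<^sup>+\<^sup>+ x y" using xy by (simp add: le_top_quot_top[OF topS])
      then have "le_top (quot_top ?S ?S') y x \<longrightarrow> ?R'\<^sup>+\<^sup>+ x y"
      proof (induction rule: converse_tranclp_induct)
        case (base u)
        then show ?case using step by blast
      next
        case (step u v)
        show ?case
        proof
          assume yu: "le_top (quot_top ?S ?S') y u"
          have uv: "le_top (quot_top ?S ?S') u v" and vy: "le_top (quot_top ?S ?S') v y"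
            using step.hyps by (auto simp: le_top_quot_top[OF topS])
          have "?R' u v" using \<open>\<And>v u. ?R u v \<Longrightarrow> le_top (quot_top ?S ?S') v u \<Longrightarrow> ?R' u v\<close>
              step.hyps(1) le_top_trans[OF vy yu] by blast
          moreover have "?R'\<^sup>+\<^sup>+ v y" using step.IH le_top_trans[OF yu uv] by blast
          ultimately show "?R'\<^sup>+\<^sup>+ u y" by (rule tranclp_into_tranclp2)
        qed
      qed
      then show ?thesis using yx by (simp add: le_top_quot_top)
    qed
    assume "equiv_top (quot_top ?S ?S') x y"
    then show "equiv_top (quot_top ?S' ?S') x y" using * by (auto simp: equiv_top_def)
  qed
  ultimately show ?thesis using finS by (simp add: admissible_def)
qed

lemma le_top_disj_union:
  assumes "topspace T1 \<inter> topspace T2 = {}"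
  shows "le_top (disj_union T1 T2) x y \<longleftrightarrow> le_top T1 x y \<or> le_top T2 x y"
proof
  have opens: "openin (disj_union T1 T2) U" if "openin T1 U \<or> openin T2 U" for U
  proof -
    have "U \<inter> topspace T1 = U \<and> U \<inter> topspace T2 = {}" if "openin T1 U"
      using openin_subset[OF that] assms by blast
    moreover have "U \<inter> topspace T2 = U \<and> U \<inter> topspace T1 = {}" if "openin T2 U"
      using openin_subset[OF that] assms by blast
    ultimately show ?thesis
      using that openin_subset[of T1 U] openin_subset[of T2 U]
      by (auto simp: openin_disj_union)
  qed
  assume le: "le_top (disj_union T1 T2) x y"
  then have "x \<in> topspace T1 \<or> x \<in> topspace T2" by (auto simp: le_top_def)
  then show "le_top T1 x y \<or> le_top T2 x y"
    using le opens by (metis le_top_def openin_topspace)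
next
  assume "le_top T1 x y \<or> le_top T2 x y"
  then show "le_top (disj_union T1 T2) x y"
    unfolding le_top_def openin_disj_union topspace_disj_union by blast
qed

lemma subtopology_disj_union:
  assumes "topspace T1 \<inter> topspace T2 = {}"
  shows "Y \<subseteq> topspace T1 \<Longrightarrow> subtopology (disj_union T1 T2) Y = subtopology T1 Y"
    and "Y \<subseteq> topspace T2 \<Longrightarrow> subtopology (disj_union T1 T2) Y = subtopology T2 Y"
proof -
  have *: "subtopology S Y = subtopology T Y"
    if "Y \<subseteq> topspace T" "\<And>U. openin S U \<Longrightarrow> openin T (U \<inter> topspace T)"
      "\<And>U. openin T U \<Longrightarrow> openin S U" for S T :: "'a topology"
    unfolding topology_eq openin_subtopology
  proof (intro allI iffI; elim exE conjE)
    fix U V assume "U = V \<inter> Y" "openin S V"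
    with that show "\<exists>W. openin T W \<and> U = W \<inter> Y" by (intro exI[of _ "V \<inter> topspace T"]) auto
  qed (use that in blast)
  have 1: "U \<inter> topspace T1 = U" "U \<inter> topspace T2 = {}" if "openin T1 U" for U
    using openin_subset[OF that] assms by blast+
  have 2: "U \<inter> topspace T2 = U" "U \<inter> topspace T1 = {}" if "openin T2 U" for U
    using openin_subset[OF that] assms by blast+
  show "Y \<subseteq> topspace T1 \<Longrightarrow> subtopology (disj_union T1 T2) Y = subtopology T1 Y"
    by (rule *) (simp_all add: openin_disj_union 1 openin_subset le_supI1)
  show "Y \<subseteq> topspace T2 \<Longrightarrow> subtopology (disj_union T1 T2) Y = subtopology T2 Y"
    by (rule *) (simp_all add: openin_disj_union 2 openin_subset le_supI2)
qed

lemma le_top_quot_disj_union: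
  assumes disj: "topspace T1 \<inter> topspace T2 = {}"
    and top: "topspace T1' = topspace T1" "topspace T2' = topspace T2"
  shows "le_top (quot_top (disj_union T1 T2) (disj_union T1' T2')) x y \<longleftrightarrow>
    le_top (quot_top T1 T1') x y \<or> le_top (quot_top T2 T2') x y"
proof -
  let ?R1 = "\<lambda>x y. le_top T1 x y \<or> le_top T1' y x"
  let ?R2 = "\<lambda>x y. le_top T2 x y \<or> le_top T2' y x"
  have R1_in: "x \<in> topspace T1 \<and> y \<in> topspace T1" if "?R1\<^sup>+\<^sup>+ x y" for x y
    using that by induction (use top le_top_in in metis)+
  have R2_in: "x \<in> topspace T2 \<and> y \<in> topspace T2" if "?R2\<^sup>+\<^sup>+ x y" for x y
    using that by induction (use top le_top_in in metis)+
  have R: "(\<lambda>x y. le_top (disj_union T1 T2) x y \<or> le_top (disj_union T1' T2') y x) =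
      (\<lambda>x y. ?R1 x y \<or> ?R2 x y)"
    using disj by (intro ext) (simp only: le_top_disj_union top, blast)
  have "(\<lambda>x y. ?R1 x y \<or> ?R2 x y)\<^sup>+\<^sup>+ x y \<longleftrightarrow> ?R1\<^sup>+\<^sup>+ x y \<or> ?R2\<^sup>+\<^sup>+ x y"
  proof
    assume "(\<lambda>x y. ?R1 x y \<or> ?R2 x y)\<^sup>+\<^sup>+ x y"
    then show "?R1\<^sup>+\<^sup>+ x y \<or> ?R2\<^sup>+\<^sup>+ x y"
    proof induction
      case (step y z)
      have y: "y \<in> topspace T1" if "?R1 y z" using that top le_top_in by metis
      have y': "y \<in> topspace T2" if "?R2 y z" using that top le_top_in by metis
      from step.IH show ?case
      proof
        assume xy: "?R1\<^sup>+\<^sup>+ x y"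
        then have "y \<notin> topspace T2" using R1_in disj by blast
        then have "?R1 y z" using step.hyps y' by blast
        with xy show ?thesis by (blast intro: tranclp.trancl_into_trancl)
      next
        assume xy: "?R2\<^sup>+\<^sup>+ x y"
        then have "y \<notin> topspace T1" using R2_in disj by blast
        then have "?R2 y z" using step.hyps y by blast
        with xy show ?thesis by (blast intro: tranclp.trancl_into_trancl)
      qed
    qed auto
  next
    assume "?R1\<^sup>+\<^sup>+ x y \<or> ?R2\<^sup>+\<^sup>+ x y"
    then show "(\<lambda>x y. ?R1 x y \<or> ?R2 x y)\<^sup>+\<^sup>+ x y"
    proof
      assume "?R1\<^sup>+\<^sup>+ x y"
      then show ?thesis by (rule tranclp_mono_rule) blast
    next
      assume "?R2\<^sup>+\<^sup>+ x y"
      then show ?thesis by (rule tranclp_mono_rule) blast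
    qed
  qed
  then show ?thesis by (simp add: le_top_quot_top top R)
qed

lemma admissible_disj_union:
  assumes adm: "admissible T1' T1" "admissible T2' T2"
    and disj: "topspace T1 \<inter> topspace T2 = {}"
  shows "admissible (disj_union T1' T2') (disj_union T1 T2)"
proof -
  let ?T = "disj_union T1 T2" and ?T' = "disj_union T1' T2'"
  have top: "topspace T1' = topspace T1" "topspace T2' = topspace T2"
    using adm by (auto simp: admissible_def finer_def)
  have disj': "topspace T1' \<inter> topspace T2' = {}" using disj top by simp
  have fin: "finer ?T' ?T"
    using adm top by (auto simp: admissible_def finer_def openin_disj_union)
  have "subtopology ?T' Y = subtopology ?T Y" if Y: "connectedin ?T' Y" for Y
  proof -
    have YX: "Y \<subseteq> topspace T1 \<union> topspace T2"
      using connectedin_subset_topspace[OF Y] top by simp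
    have inter: "topspace T2 \<inter> topspace T1 = {}" using disj by blast
    have "openin ?T' (topspace T1)" "openin ?T' (topspace T2)"
      using openin_topspace[of T1'] openin_topspace[of T2']
      by (auto simp: openin_disj_union top disj inter simp del: openin_topspace)
    then have "topspace T1 \<inter> Y = {} \<or> topspace T2 \<inter> Y = {}"
      using Y YX disj unfolding connectedin by blast
    then consider "Y \<subseteq> topspace T1" | "Y \<subseteq> topspace T2" using YX by blast
    then show ?thesis
    proof cases
      case 1
      have "subtopology ?T' Y = subtopology T1' Y" "subtopology ?T Y = subtopology T1 Y"
        using 1 top by (auto intro!: subtopology_disj_union(1) disj disj')
      moreover from this have "connectedin T1' Y"
        using Y 1 top by (simp add: connectedin_def)
      ultimately show ?thesis using adm(1) by (simp add: admissible_def)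
    next
      case 2
      have "subtopology ?T' Y = subtopology T2' Y" "subtopology ?T Y = subtopology T2 Y"
        using 2 top by (auto intro!: subtopology_disj_union(2) disj disj')
      moreover from this have "connectedin T2' Y"
        using Y 2 top by (simp add: connectedin_def)
      ultimately show ?thesis using adm(2) by (simp add: admissible_def)
    qed
  qed
  moreover have "equiv_top (quot_top ?T ?T') x y \<longleftrightarrow> equiv_top (quot_top ?T' ?T') x y" for x y
  proof -
    have sp: "le_top (quot_top T1 T1') x y \<Longrightarrow> x \<in> topspace T1 \<and> y \<in> topspace T1"
      "le_top (quot_top T2 T2') x y \<Longrightarrow> x \<in> topspace T2 \<and> y \<in> topspace T2"
      "le_top (quot_top T1' T1') x y \<Longrightarrow> x \<in> topspace T1 \<and> y \<in> topspace T1"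
      "le_top (quot_top T2' T2') x y \<Longrightarrow> x \<in> topspace T2 \<and> y \<in> topspace T2" for x y
      by (auto dest!: le_top_in simp: top)
    have "equiv_top (quot_top ?T ?T') x y \<longleftrightarrow>
        equiv_top (quot_top T1 T1') x y \<or> equiv_top (quot_top T2 T2') x y"
      unfolding equiv_top_def le_top_quot_disj_union[OF disj top] using sp disj by blast
    moreover have "equiv_top (quot_top ?T' ?T') x y \<longleftrightarrow>
        equiv_top (quot_top T1' T1') x y \<or> equiv_top (quot_top T2' T2') x y"
      unfolding equiv_top_def le_top_quot_disj_union[OF disj' refl refl] using sp disj by blast
    moreover have "equiv_top (quot_top T1 T1') x y \<longleftrightarrow> equiv_top (quot_top T1' T1') x y"
      using adm(1) sp unfolding admissible_def equiv_top_def by blast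
    moreover have "equiv_top (quot_top T2 T2') x y \<longleftrightarrow> equiv_top (quot_top T2' T2') x y"
      using adm(2) sp unfolding admissible_def equiv_top_def by blast
    ultimately show ?thesis by simp
  qed
  ultimately show ?thesis using fin by (simp add: admissible_def)
qed


subsection \<open>Linear algebra\<close>

lemma lookup_scale [simp]: "Poly_Mapping.lookup (scale c v) b = c * Poly_Mapping.lookup v b"
  by (simp add: scale_def Poly_Mapping.map.rep_eq when_def)

lemma scale_0 [simp]: "scale 0 v = 0" "scale c 0 = 0"
  by (rule poly_mapping_eqI, simp)+

lemma scale_1 [simp]: "scale 1 v = v"
  by (rule poly_mapping_eqI) simp

lemma scale_add_left: "scale (c + d) v = scale c v + scale d v"
  by (rule poly_mapping_eqI) (simp add: lookup_add algebra_simps)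

lemma scale_add_right: "scale c (v + w) = scale c v + scale c w"
  by (rule poly_mapping_eqI) (simp add: lookup_add algebra_simps)

lemma scale_scale: "scale c (scale d v) = scale (c * d) v"
  by (rule poly_mapping_eqI) (simp add: algebra_simps)

lemma scale_sum: "scale c (sum f A) = (\<Sum>a\<in>A. scale c (f a))"
  by (induction A rule: infinite_finite_induct) (simp_all add: scale_add_right)

lemma lin_ext_superset:
  assumes "finite A" "Poly_Mapping.keys v \<subseteq> A"
  shows "lin_ext f v = (\<Sum>b\<in>A. scale (Poly_Mapping.lookup v b) (f b))"
  unfolding lin_ext_def
  using assms by (intro sum.mono_neutral_left) (auto simp: in_keys_iff)

lemma lin_ext_basis_vec [simp]: "lin_ext f (basis_vec b) = f b"
  by (subst lin_ext_superset[of "{b}"]) (auto simp: basis_vec_def)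

lemma lin_ext_add: "lin_ext f (v + w) = lin_ext f v + lin_ext f w"
proof -
  let ?A = "Poly_Mapping.keys v \<union> Poly_Mapping.keys w"
  have "Poly_Mapping.keys (v + w) \<subseteq> ?A" by (rule Poly_Mapping.keys_add)
  then show ?thesis
    by (simp add: lin_ext_superset[of ?A] lookup_add scale_add_left sum.distrib)
qed

lemma lin_ext_scale: "lin_ext f (scale c v) = scale c (lin_ext f v)"
proof -
  have "Poly_Mapping.keys (scale c v) \<subseteq> Poly_Mapping.keys v"
    by (auto simp: in_keys_iff)
  then show ?thesis
    by (simp add: lin_ext_superset[of "Poly_Mapping.keys v"] scale_scale scale_sum)
qed

lemma tensor_basis_vec [simp]: "tensor (basis_vec b) (basis_vec c) = basis_vec (b, c)"
  by (simp add: tensor_def)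

lemma basis_vec_in [simp]: "basis_vec b \<in> free_space B \<longleftrightarrow> b \<in> B"
  by (simp add: free_space_def basis_vec_def)

lemma sum_in_free_space:
  assumes "\<And>a. a \<in> A \<Longrightarrow> f a \<in> free_space B" shows "sum f A \<in> free_space B"
  using assms
proof (induction A rule: infinite_finite_induct)
  case (insert a A)
  then show ?case using Poly_Mapping.keys_add[of "f a" "sum f A"] by (auto simp: free_space_def)
qed (auto simp: free_space_def)

lemma lin_ext_in_free_space:
  assumes "v \<in> free_space B" "\<And>b. b \<in> B \<Longrightarrow> f b \<in> free_space C"
  shows "lin_ext f v \<in> free_space C"
  unfolding lin_ext_def
proof (rule sum_in_free_space)
  fix b assume "b \<in> Poly_Mapping.keys v"
  then have "f b \<in> free_space C" using assms by (auto simp: free_space_def)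
  then show "scale (Poly_Mapping.lookup v b) (f b) \<in> free_space C"
    by (auto simp: free_space_def in_keys_iff)
qed

lemma tensor_in:
  assumes "v \<in> free_space B" "w \<in> free_space C" shows "tensor v w \<in> free_space (B \<times> C)"
  unfolding tensor_def
  by (intro lin_ext_in_free_space[OF assms(1)] lin_ext_in_free_space[OF assms(2)]) simp

lemma finite_topologies:
  assumes "finite X" shows "finite {T. topspace T = X}"
proof (rule finite_imageD)
  show "inj_on (\<lambda>T. Collect (openin T)) {T. topspace T = X}"
    by (auto simp: inj_on_def topology_eq)
  show "finite ((\<lambda>T. Collect (openin T)) ` {T. topspace T = X})"
    by (rule finite_subset[of _ "Pow (Pow X)"]) (use assms openin_subset in auto)
qed


subsection \<open>The maps have the expected domains and codomains\<close>

lemma \<Delta>_in: "v \<in> free_space (D_basis X) \<Longrightarrow> \<Delta> v \<in> free_space (DD_basis X)"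
  unfolding \<Delta>_def
proof (erule lin_ext_in_free_space, clarify, intro sum_in_free_space)
  fix T Y Z assume "(T, Y) \<in> D_basis X" "Z \<in> Collect (openin (subtopology T Y))"
  then have T: "topspace T = X" "openin T Y" "openin (subtopology T Y) Z"
    by (auto simp: D_basis_def)
  then have Z: "openin T Z" "Z \<subseteq> X" using openin_trans_full openin_subset by blast+
  then have "(subtopology T Z, Z) \<in> D_basis Z"
    using T by (auto simp: D_basis_def openin_subtopology_refl)
  moreover have "(subtopology T (X - Z), Y - Z) \<in> D_basis (X - Z)"
    using T openin_subset[OF T(2)] by (auto simp: D_basis_def openin_subtopology)
  ultimately show "tensor (basis_vec (subtopology T Z, Z))
      (basis_vec (subtopology T (topspace T - Z), Y - Z)) \<in> free_space (DD_basis X)"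
    using T Z by (auto simp: DD_basis_def)
qed

lemma \<Phi>_in: "v \<in> free_space (D_basis X) \<Longrightarrow> \<Phi> v \<in> free_space (Dt_basis X \<times> D_basis X)"
  unfolding \<Phi>_def
  by (erule lin_ext_in_free_space, clarify, intro sum_in_free_space)
    (auto simp: D_basis_def Dt_basis_def)

lemma m13_in:
  "v \<in> free_space (DtDDtD_basis X) \<Longrightarrow> m13 v \<in> free_space (Dt_basis X \<times> DD_basis X)"
  unfolding m13_def
proof (erule lin_ext_in_free_space, clarify)
  fix T1 T1' b1 c1 T2 T2' b2 c2
  assume "(((T1, T1'), b1, c1), (T2, T2'), b2, c2) \<in> DtDDtD_basis X"
  then obtain Y where "Y \<subseteq> X" "topspace T1 = Y" "topspace T2 = X - Y"
    "admissible T1' T1" "admissible T2' T2" "(b1, c1) \<in> D_basis Y" "(b2, c2) \<in> D_basis (X - Y)"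
    by (auto simp: DtDDtD_basis_def Dt_basis_def)
  then show "tensor (basis_vec (Dt_mult (T1, T1') (T2, T2')))
      (tensor (basis_vec (b1, c1)) (basis_vec (b2, c2))) \<in> free_space (Dt_basis X \<times> DD_basis X)"
    by (auto simp: DD_basis_def Dt_basis_def intro!: admissible_disj_union)
qed

lemma \<xi>_in:
  "v \<in> free_space (Dt_basis X \<times> DD_basis X) \<Longrightarrow> \<xi> v \<in> free_space (Dt_basis X \<times> DD_basis X)"
  unfolding \<xi>_def
proof (erule lin_ext_in_free_space, clarify)
  fix T T' T1 Z T2 W
  assume *: "(T, T') \<in> Dt_basis X" "((T1, Z), (T2, W)) \<in> DD_basis X"
  then have "topspace T = X" "topspace T' = X" "Z \<subseteq> X" "admissible T' T"
    using openin_subset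
    by (fastforce simp: Dt_basis_def DD_basis_def D_basis_def admissible_def finer_def)+
  then have "(disj_union (subtopology T Z) (subtopology T (topspace T - Z)),
      disj_union (subtopology T' Z) (subtopology T' (topspace T - Z))) \<in> Dt_basis X"
    by (auto simp: Dt_basis_def intro!: admissible_disj_union admissible_subtopology)
  then show "tensor (basis_vec
        (disj_union (subtopology T Z) (subtopology T (topspace T - Z)),
         disj_union (subtopology T' Z) (subtopology T' (topspace T - Z))))
      (tensor (basis_vec (T1, Z)) (basis_vec (T2, W))) \<in> free_space (Dt_basis X \<times> DD_basis X)"
    using *(2) by simp
qed

lemma tensor_map_in:
  assumes "v \<in> free_space (B \<times> C)"
    and "\<And>b. b \<in> B \<Longrightarrow> f (basis_vec b) \<in> free_space D"
    and "\<And>c. c \<in> C \<Longrightarrow> g (basis_vec c) \<in> free_space E"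
  shows "tensor_map f g v \<in> free_space (D \<times> E)"
  unfolding tensor_map_def
  using assms(1) by (rule lin_ext_in_free_space) (auto intro!: tensor_in assms(2,3))

lemma tensor_map_id_\<Delta>_in:
  "v \<in> free_space (Dt_basis X \<times> D_basis X) \<Longrightarrow>
    tensor_map id \<Delta> v \<in> free_space (Dt_basis X \<times> DD_basis X)"
  by (erule tensor_map_in) (auto intro!: \<Delta>_in)

lemma tensor_map_\<Phi>_\<Phi>_in:
  assumes "v \<in> free_space (DD_basis X)"
  shows "tensor_map \<Phi> \<Phi> v \<in> free_space (DtDDtD_basis X)"
  unfolding tensor_map_def
  using assms
proof (rule lin_ext_in_free_space, clarify)
  fix T1 Y1 T2 Y2 assume "((T1, Y1), (T2, Y2)) \<in> DD_basis X"
  then obtain Y where Y: "Y \<subseteq> X" "(T1, Y1) \<in> D_basis Y" "(T2, Y2) \<in> D_basis (X - Y)"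
    by (auto simp: DD_basis_def)
  have "tensor (\<Phi> (basis_vec (T1, Y1))) (\<Phi> (basis_vec (T2, Y2)))
      \<in> free_space ((Dt_basis Y \<times> D_basis Y) \<times> (Dt_basis (X - Y) \<times> D_basis (X - Y)))"
    using Y by (intro tensor_in \<Phi>_in) simp_all
  then show "tensor (\<Phi> (basis_vec (T1, Y1))) (\<Phi> (basis_vec (T2, Y2)))
      \<in> free_space (DtDDtD_basis X)"
    using Y(1) by (auto simp: free_space_def DtDDtD_basis_def)
qed

end

theory Submission
  imports Defs
begin

text \<open>On a finite set, the open sets of \<open>T/T'\<close> are the sets which are open for \<open>T\<close> and closed
  for \<open>T'\<close>, hence clopen for \<open>T'\<close> if \<open>T'\<close> is finer than \<open>T\<close>. So if \<open>Z\<close> is open for \<open>T/T'\<close>, then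
  \<open>T'\<close> is the disjoint union of its restrictions to \<open>Z\<close> and \<open>X - Z\<close>; both sets are convex for
  \<open>T/T'\<close>, so that quotients commute with restriction to them. Conversely, if \<open>Z\<close> is \<open>T\<close>-open and
  \<open>T1\<close>, \<open>T2\<close> are admissible for the two restrictions of \<open>T\<close>, then a cycle witnessing an equivalence
  in the quotient of \<open>T\<close> by \<open>T1 T2\<close> cannot leave \<open>Z\<close> or \<open>X - Z\<close>, and \<open>T1 T2\<close> is \<open>T\<close>-admissible.
  Thus \<open>(T', Z) \<mapsto> (Z, T'|Z, T'|(X - Z))\<close> matches the terms of the two sides.\<close>

section \<open>Finite topologies\<close>

text \<open>Finiteness makes the intersection of all open neighbourhoods of a point open. Its
  elements are the points above the given one, so every upper ideal is a union of open sets.\<close>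

lemma openin_iff_le_top:
  assumes "finite (topspace T)"
  shows "openin T U \<longleftrightarrow> U \<subseteq> topspace T \<and> (\<forall>x\<in>U. \<forall>y. le_top T x y \<longrightarrow> y \<in> U)"
proof
  assume U: "U \<subseteq> topspace T \<and> (\<forall>x\<in>U. \<forall>y. le_top T x y \<longrightarrow> y \<in> U)"
  show "openin T U"
  proof (subst openin_subopen, intro ballI)
    fix x assume x: "x \<in> U"
    let ?M = "\<Inter>{V. openin T V \<and> x \<in> V}"
    have "finite {V. openin T V \<and> x \<in> V}"
      by (rule finite_subset[of _ "Pow (topspace T)"]) (use assms openin_subset in auto)
    moreover have "{V. openin T V \<and> x \<in> V} \<noteq> {}"
      using x U openin_topspace by blast
    ultimately have "openin T ?M" by (intro openin_Inter) auto
    moreover have "?M \<subseteq> U"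
    proof
      fix y assume y: "y \<in> ?M"
      then have "le_top T x y" using x U by (auto simp: le_top_def)
      then show "y \<in> U" using x U by blast
    qed
    ultimately show "\<exists>V. openin T V \<and> x \<in> V \<and> V \<subseteq> U" by (intro exI[of _ ?M]) auto
  qed
qed (auto simp: le_top_def dest: openin_subset)

lemma topology_eqI_le_top:
  assumes "finite (topspace T)" "topspace S = topspace T"
    and "\<And>x y. le_top S x y \<longleftrightarrow> le_top T x y"
  shows "S = T"
  using assms by (simp add: topology_eq openin_iff_le_top)

text \<open>A set is stable under a transitive closure iff it is stable under the generating steps.
  Stability under \<open>le_top T\<close> means \<open>T\<close>-open, and stability under the
  converse of \<open>le_top T'\<close> means \<open>T'\<close>-closed.\<close>

lemma openin_quot_top:
  assumes "finite (topspace T)" "topspace T' = topspace T"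
  shows "openin (quot_top T T') U \<longleftrightarrow> openin T U \<and> closedin T' U"
proof -
  let ?R = "\<lambda>x y. le_top T x y \<or> le_top T' y x"
  have "closedin T' U \<longleftrightarrow> U \<subseteq> topspace T \<and> (\<forall>x\<in>U. \<forall>y. le_top T' y x \<longrightarrow> y \<in> U)"
    using assms by (auto simp: closedin_def openin_iff_le_top dest: le_top_in)
  moreover have "openin (quot_top T T') U \<longleftrightarrow>
      U \<subseteq> topspace T \<and> (\<forall>x\<in>U. \<forall>y. ?R\<^sup>+\<^sup>+ x y \<longrightarrow> y \<in> U)"
    using assms by (simp add: openin_iff_le_top le_top_quot_top)
  moreover have "y \<in> U" if "?R\<^sup>+\<^sup>+ x y" "x \<in> U" "\<And>x y. x \<in> U \<Longrightarrow> ?R x y \<Longrightarrow> y \<in> U" for x y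
    using that(1,2) by induction (use that(3) in blast)+
  ultimately show ?thesis
    using assms by (simp add: openin_iff_le_top) (blast intro: tranclp.r_into_trancl)
qed

lemma topspace_admissible: "admissible T' T \<Longrightarrow> topspace T' = topspace T"
  by (simp add: admissible_def finer_def)

lemma openin_admissible: "admissible T' T \<Longrightarrow> openin T U \<Longrightarrow> openin T' U"
  by (simp add: admissible_def finer_def)

section \<open>Quotients restricted to convex subsets\<close>

text \<open>A chain of generating steps between two points of \<open>S\<close> passes only through
  points lying between them, so convexity keeps the whole chain inside \<open>S\<close>.\<close>

lemma le_top_quot_subtopology:
  assumes top: "topspace T' = topspace T"
    and convex: "\<And>x y z. x \<in> S \<Longrightarrow> z \<in> S \<Longrightarrow> le_top (quot_top T T') x y \<Longrightarrow>
      le_top (quot_top T T') y z \<Longrightarrow> y \<in> S"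
  shows "le_top (quot_top (subtopology T S) (subtopology T' S)) x y \<longleftrightarrow>
    x \<in> S \<and> y \<in> S \<and> le_top (quot_top T T') x y"
proof -
  let ?R = "\<lambda>x y. le_top T x y \<or> le_top T' y x"
  let ?S = "\<lambda>x y. le_top (subtopology T S) x y \<or> le_top (subtopology T' S) y x"
  have "?S\<^sup>+\<^sup>+ x y" if "?R\<^sup>+\<^sup>+ x y" "x \<in> S" "y \<in> S"
    using that
  proof induction
    case (base y)
    then show ?case by (auto simp: le_top_subtopology)
  next
    case (step y z)
    \<comment> \<open>The induction hypothesis covers only chains ending in \<open>S\<close>;
      \<open>y\<close> lies between \<open>x\<close> and \<open>z\<close> in the quotient
      order.\<close>
    have "y \<in> S"
      using convex[of x z y] step.hyps step.prems by (auto simp: le_top_quot_top[OF top])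
    then have "?S\<^sup>+\<^sup>+ x y" "?S y z"
      using step by (auto simp: le_top_subtopology)
    then show ?case by (rule tranclp.trancl_into_trancl)
  qed
  moreover have "x \<in> S \<and> y \<in> S" if "?S\<^sup>+\<^sup>+ x y"
    using that by induction (auto simp: le_top_subtopology)
  moreover have "?R\<^sup>+\<^sup>+ x y" if "?S\<^sup>+\<^sup>+ x y"
    using that by (rule tranclp_mono_rule) (auto simp: le_top_subtopology)
  ultimately show ?thesis by (auto simp: le_top_quot_top top)
qed

text \<open>An open \<open>Z\<close> is an upper set and its complement a lower set of the quotient
  order, hence both are convex.\<close>

lemma le_top_quot_subtopology_open:
  assumes "topspace T' = topspace T" "openin (quot_top T T') Z"
  shows "le_top (quot_top (subtopology T Z) (subtopology T' Z)) x y \<longleftrightarrow>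
      x \<in> Z \<and> y \<in> Z \<and> le_top (quot_top T T') x y"
    and "le_top (quot_top (subtopology T (topspace T - Z)) (subtopology T' (topspace T - Z))) x y \<longleftrightarrow>
      x \<notin> Z \<and> y \<notin> Z \<and> le_top (quot_top T T') x y"
proof -
  have up: "y \<in> Z" if "x \<in> Z" "le_top (quot_top T T') x y" for x y
    using assms(2) that by (auto simp: le_top_def)
  show "le_top (quot_top (subtopology T Z) (subtopology T' Z)) x y \<longleftrightarrow>
      x \<in> Z \<and> y \<in> Z \<and> le_top (quot_top T T') x y"
    by (rule le_top_quot_subtopology[OF assms(1)]) (rule up)
  have "le_top (quot_top (subtopology T (topspace T - Z)) (subtopology T' (topspace T - Z))) x y \<longleftrightarrow>
      x \<in> topspace T - Z \<and> y \<in> topspace T - Z \<and> le_top (quot_top T T') x y"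
    by (rule le_top_quot_subtopology[OF assms(1)]) (use up in \<open>auto dest: le_top_in\<close>)
  then show "le_top (quot_top (subtopology T (topspace T - Z)) (subtopology T' (topspace T - Z))) x y
      \<longleftrightarrow> x \<notin> Z \<and> y \<notin> Z \<and> le_top (quot_top T T') x y"
    by (auto dest: le_top_in)
qed

lemma quot_subtopology_open:
  assumes "finite (topspace T)" "topspace T' = topspace T" "openin (quot_top T T') Z"
  shows "quot_top (subtopology T Z) (subtopology T' Z) = subtopology (quot_top T T') Z"
    and "quot_top (subtopology T (topspace T - Z)) (subtopology T' (topspace T - Z)) =
      subtopology (quot_top T T') (topspace T - Z)"
  using assms le_top_in[of "quot_top T T'"]
  by (auto intro!: topology_eqI_le_top simp: le_top_quot_subtopology_open le_top_subtopology)

section \<open>Clopen splittings and gluing\<close>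

text \<open>For clopen \<open>Z\<close>, a set is open as soon as its traces on \<open>Z\<close> and
  on the complement are. This recovers \<open>T'\<close> from its two restrictions.\<close>

lemma disj_union_subtopology_clopen:
  assumes "openin T Z" "closedin T Z"
  shows "disj_union (subtopology T Z) (subtopology T (topspace T - Z)) = T"
proof -
  have C: "openin T (topspace T - Z)" using assms(2) by blast
  have ZX: "Z \<subseteq> topspace T" using assms(1) by (rule openin_subset)
  have glue: "U \<subseteq> topspace T \<and> openin T (U \<inter> Z) \<and> openin T (U \<inter> (topspace T - Z)) \<longleftrightarrow> openin T U"
    for U
  proof
    assume U: "U \<subseteq> topspace T \<and> openin T (U \<inter> Z) \<and> openin T (U \<inter> (topspace T - Z))"
    then have "U = (U \<inter> Z) \<union> (U \<inter> (topspace T - Z))" by blast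
    then show "openin T U" using U openin_Un by metis
  qed (use assms(1) C openin_subset in blast)
  moreover have "Z \<union> (topspace T - Z) = topspace T" "topspace T \<inter> Z = Z"
    "topspace T \<inter> (topspace T - Z) = topspace T - Z" using ZX by blast+
  ultimately show ?thesis
    by (simp add: topology_eq openin_disj_union openin_open_subtopology assms(1) C glue
        del: Un_Diff_cancel)
qed

lemma connectedin_clopen_cases:
  assumes "connectedin T Y" "openin T Z" "closedin T Z"
  shows "Y \<subseteq> Z \<or> Y \<subseteq> topspace T - Z"
proof -
  have "openin T (topspace T - Z)" using assms(3) by blast
  then show ?thesis
    using assms(1,2) connectedin_subset_topspace[OF assms(1)] unfolding connectedin by blast
qed

lemma disj_union_complement:
  assumes "Z \<subseteq> X" "topspace T1 = Z" "topspace T2 = X - Z"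
  shows "openin (disj_union T1 T2) Z" "closedin (disj_union T1 T2) Z"
    and "subtopology (disj_union T1 T2) Z = T1" "subtopology (disj_union T1 T2) (X - Z) = T2"
proof -
  have disj: "topspace T1 \<inter> topspace T2 = {}" using assms by auto
  have top: "topspace (disj_union T1 T2) = X" using assms by auto
  have eq: "(X - Z) \<inter> Z = {}" "X \<inter> Z = Z" "X \<inter> (X - Z) = X - Z" "Z \<union> X = X" using assms(1) by auto
  have "openin T1 Z" "openin T2 (X - Z)" using assms openin_topspace by metis+
  then show "openin (disj_union T1 T2) Z" "closedin (disj_union T1 T2) Z"
    using assms(1) by (auto simp: closedin_def top openin_disj_union assms(2,3) eq)
  show "subtopology (disj_union T1 T2) Z = T1" "subtopology (disj_union T1 T2) (X - Z) = T2"
    using subtopology_disj_union[OF disj] assms by (metis order_refl subtopology_topspace)+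
qed

lemma openin_quot_disj_union:
  assumes "finite (topspace T)" "openin T Z" "topspace T1 = Z" "topspace T2 = topspace T - Z"
  shows "openin (quot_top T (disj_union T1 T2)) Z"
  using assms disj_union_complement[OF openin_subset[OF assms(2)] assms(3,4)]
    openin_subset[OF assms(2)]
  by (subst openin_quot_top) auto

text \<open>Admissibility for the disjoint union of the two restrictions is already known, and it
  carries over to \<open>T\<close>: a \<open>T'\<close>-connected set lies on one side of
  \<open>Z\<close>, where both topologies agree, and no class of the quotient meets both
  sides.\<close>

lemma admissible_glue:
  assumes fin: "finite (topspace T)" and Z: "openin T Z"
    and adm: "admissible T1 (subtopology T Z)" "admissible T2 (subtopology T (topspace T - Z))"
  shows "admissible (disj_union T1 T2) T"
proof -
  let ?X = "topspace T" and ?T' = "disj_union T1 T2"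
  \<comment> \<open>\<open>?S\<close> is \<open>T\<close> with the relations between
    \<open>Z\<close> and its complement removed; it mediates between \<open>?T'\<close> and
    \<open>T\<close>.\<close>
  let ?S = "disj_union (subtopology T Z) (subtopology T (?X - Z))"
  have ZX: "Z \<subseteq> ?X" using Z by (rule openin_subset)
  have top1: "topspace T1 = Z" and top2: "topspace T2 = ?X - Z"
    using topspace_admissible[OF adm(1)] topspace_admissible[OF adm(2)] ZX by auto
  have top': "topspace ?T' = ?X" and topS: "topspace ?S = ?X" using top1 top2 ZX by auto
  note glue = disj_union_complement[OF ZX top1 top2]
  have tops: "topspace (subtopology T Z) = Z" "topspace (subtopology T (?X - Z)) = ?X - Z"
    using ZX by auto
  note glueS = disj_union_complement[OF ZX tops]
  have admS: "admissible ?T' ?S" using adm by (intro admissible_disj_union) auto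
  have "openin ?S U" if "openin T U" for U
    using that openin_subset[OF that] ZX by (auto simp: openin_disj_union openin_subtopology)
  then have fine: "finer ?T' T" using openin_admissible[OF admS] top' by (simp add: finer_def)
  have open_quot: "openin (quot_top T ?T') Z"
    using fin Z top1 top2 by (rule openin_quot_disj_union)
  have "subtopology ?T' Y = subtopology T Y" if Y: "connectedin ?T' Y" for Y
  proof -
    have "Y \<subseteq> Z \<or> Y \<subseteq> ?X - Z"
      using connectedin_clopen_cases[OF Y glue(1,2)] top' by simp
    then have "subtopology ?S Y = subtopology T Y"
      using glueS(3,4) by (metis Int_absorb1 subtopology_subtopology)
    then show ?thesis using admS Y by (simp add: admissible_def)
  qed
  moreover have "equiv_top (quot_top T ?T') x y \<longleftrightarrow> equiv_top (quot_top ?T' ?T') x y"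
    if "x \<in> ?X" "y \<in> ?X" for x y
  proof
    assume "equiv_top (quot_top ?T' ?T') x y"
    then show "equiv_top (quot_top T ?T') x y"
      using quot_top_mono[OF fine] by (auto simp: equiv_top_def)
  next
    assume eq: "equiv_top (quot_top T ?T') x y"
    \<comment> \<open>Equivalent points belong to the same open sets of the quotient, and
      \<open>Z\<close> is one of them. So the equivalence can be read off in one of the two
      restrictions.\<close>
    then have "x \<in> Z \<longleftrightarrow> y \<in> Z" using open_quot by (auto simp: equiv_top_def le_top_def)
    then have "equiv_top (quot_top (subtopology T Z) T1) x y \<or>
        equiv_top (quot_top (subtopology T (?X - Z)) T2) x y"
      using le_top_quot_subtopology_open[OF top' open_quot, of x y]
        le_top_quot_subtopology_open[OF top' open_quot, of y x] eq glue(3,4)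
      by (auto simp: equiv_top_def)
    then have "equiv_top (quot_top ?S ?T') x y"
      using le_top_quot_disj_union[of "subtopology T Z" "subtopology T (?X - Z)" T1 T2]
        top1 top2 ZX by (auto simp: equiv_top_def)
    then show "equiv_top (quot_top ?T' ?T') x y"
      using admS that topS by (simp add: admissible_def)
  qed
  ultimately show ?thesis using fine by (simp add: admissible_def)
qed


section \<open>The matching of the terms\<close>

text \<open>The index set of the sum in \<open>\<Phi>\<close>, named so that the terms of the two
  composites can be matched bijectively.\<close>

definition \<Phi>_index :: "'a topology \<Rightarrow> 'a set \<Rightarrow> 'a topology set" where
  "\<Phi>_index T Y = {T'. admissible T' T \<and> openin (quot_top T T') Y \<and>
     subtopology T' (topspace T - Y) = finest_admissible (subtopology T' (topspace T - Y))}"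

lemma finite_\<Phi>_index: "finite (topspace T) \<Longrightarrow> finite (\<Phi>_index T Y)"
  by (rule finite_subset[OF _ finite_topologies]) (auto simp: \<Phi>_index_def topspace_admissible)

lemma finite_openin:
  assumes "finite (topspace T)" shows "finite {U. openin T U}"
  by (rule finite_subset[of _ "Pow (topspace T)"]) (use assms openin_subset in auto)

text \<open>Passage from a term of the left side to one of the right side. As \<open>Y\<close> is
  open in the quotient, so is \<open>Z\<close>; hence \<open>Z\<close> is \<open>T\<close>-open and
  \<open>T'\<close>-clopen, and quotients commute with restriction to \<open>Z\<close> and to its
  complement.\<close>

lemma \<Phi>_index_split:
  assumes fin: "finite (topspace T)" and T': "T' \<in> \<Phi>_index T Y"
    and Z: "openin (subtopology (quot_top T T') Y) Z"
  shows "openin (subtopology T Y) Z" "openin (quot_top T T') Z" "topspace T' = topspace T"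
    and "disj_union (subtopology T' Z) (subtopology T' (topspace T - Z)) = T'"
    and "subtopology T' Z \<in> \<Phi>_index (subtopology T Z) Z"
    and "subtopology T' (topspace T - Z) \<in> \<Phi>_index (subtopology T (topspace T - Z)) (Y - Z)"
proof -
  let ?X = "topspace T"
  have adm: "admissible T' T" and Y: "openin (quot_top T T') Y"
    and D: "subtopology T' (?X - Y) = finest_admissible (subtopology T' (?X - Y))"
    using T' by (auto simp: \<Phi>_index_def)
  then have fine: "finer T' T" by (simp add: admissible_def)
  show top: "topspace T' = ?X" using fine by (simp add: finer_def)
  show ZQ: "openin (quot_top T T') Z" using openin_trans_full[OF Z Y] .
  have ZT: "openin T Z" "closedin T' Z" and YT: "openin T Y"
    using ZQ Y by (auto simp: openin_quot_top fin top)
  have ZX: "Z \<subseteq> ?X" using ZT openin_subset by blast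
  have ZY: "Z \<subseteq> Y" using openin_subset[OF Z] by auto
  show "openin (subtopology T Y) Z" using ZT YT ZY by (simp add: openin_open_subtopology)
  have "openin T' Z" using fine ZT by (simp add: finer_def)
  then show "disj_union (subtopology T' Z) (subtopology T' (?X - Z)) = T'"
    using disj_union_subtopology_clopen[of T' Z] ZT top by simp
  show "subtopology T' Z \<in> \<Phi>_index (subtopology T Z) Z"
  proof -
    have "openin (subtopology (quot_top T T') Z) Z" using ZX by (simp add: openin_subtopology_refl)
    \<comment> \<open>On the piece \<open>Z\<close> the marked open set is all of \<open>Z\<close>,
      so the condition on the finest admissible topology concerns the empty space.\<close>
    moreover have "subtopology S (Z - Z) = finest_admissible (subtopology S (Z - Z))"
      for S :: "'a topology"
      by (rule topology_eqI_le_top) (auto simp: finest_admissible_eq dest: le_top_in)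
    ultimately show ?thesis
      using admissible_subtopology[OF adm, of Z] ZX
      by (simp add: \<Phi>_index_def quot_subtopology_open fin top ZQ Int_absorb1)
  qed
  show "subtopology T' (?X - Z) \<in> \<Phi>_index (subtopology T (?X - Z)) (Y - Z)"
  proof -
    have "openin (subtopology (quot_top T T') (?X - Z)) (Y - Z)"
      using Y openin_subset[OF YT] by (auto simp: openin_subtopology)
    \<comment> \<open>The complement of \<open>Y - Z\<close> in \<open>?X - Z\<close> is again
      \<open>?X - Y\<close>, so the condition \<open>D\<close> passes over unchanged.\<close>
    moreover have "(?X - Z) \<inter> (?X - Z - (Y - Z)) = ?X - Y" "?X \<inter> (?X - Z) = ?X - Z"
      using ZY by auto
    ultimately show ?thesis
      using admissible_subtopology[OF adm, of "?X - Z"] D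
      by (simp add: \<Phi>_index_def quot_subtopology_open fin top ZQ subtopology_subtopology)
  qed
qed

text \<open>The reverse passage. The point to check is that \<open>Y\<close> is closed for the glued
  topology; being \<open>T\<close>-open, it is then open in the quotient.\<close>

lemma \<Phi>_index_glue:
  assumes fin: "finite (topspace T)" and Y: "openin T Y" and Z: "openin (subtopology T Y) Z"
    and T1: "T1 \<in> \<Phi>_index (subtopology T Z) Z"
    and T2: "T2 \<in> \<Phi>_index (subtopology T (topspace T - Z)) (Y - Z)"
  shows "disj_union T1 T2 \<in> \<Phi>_index T Y"
    and "openin (subtopology (quot_top T (disj_union T1 T2)) Y) Z"
    and "subtopology (disj_union T1 T2) Z = T1"
    and "subtopology (disj_union T1 T2) (topspace T - Z) = T2"
proof -
  let ?X = "topspace T" and ?T' = "disj_union T1 T2"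
  have ZT: "openin T Z" using openin_trans_full[OF Z Y] .
  have ZX: "Z \<subseteq> ?X" using ZT openin_subset by blast
  have ZY: "Z \<subseteq> Y" using openin_subset[OF Z] by auto
  have adm: "admissible T1 (subtopology T Z)" "admissible T2 (subtopology T (?X - Z))"
    and Y2: "openin (quot_top (subtopology T (?X - Z)) T2) (Y - Z)"
    and D: "subtopology T2 (topspace (subtopology T (?X - Z)) - (Y - Z)) =
      finest_admissible (subtopology T2 (topspace (subtopology T (?X - Z)) - (Y - Z)))"
    using T1 T2 by (auto simp: \<Phi>_index_def)
  have top1: "topspace T1 = Z" and top2: "topspace T2 = ?X - Z"
    using topspace_admissible[OF adm(1)] topspace_admissible[OF adm(2)] ZX by auto
  have top: "topspace ?T' = ?X" using top1 top2 ZX by auto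
  note glue = disj_union_complement[OF ZX top1 top2]
  show "subtopology ?T' Z = T1" "subtopology ?T' (?X - Z) = T2" using glue by auto
  \<comment> \<open>\<open>Y - Z\<close> is closed in the closed subspace \<open>?X - Z\<close>,
    hence closed in the whole; adding the closed set \<open>Z\<close> gives
    \<open>Y\<close>.\<close>
  have "closedin T2 (Y - Z)"
    using Y2 fin top2 by (subst (asm) openin_quot_top) auto
  moreover have "closedin ?T' (?X - Z)" using glue(1) by (metis openin_closedin_eq top)
  ultimately have "closedin ?T' (Y - Z)"
    using glue(4) closedin_trans_full by metis
  then have "closedin ?T' ((Y - Z) \<union> Z)" using glue(2) by (rule closedin_Un)
  then have "closedin ?T' Y" using ZY by (simp add: Un_absorb2)
  then have YQ: "openin (quot_top T ?T') Y" using Y fin top by (simp add: openin_quot_top)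
  moreover have "subtopology ?T' (?X - Y) =
      subtopology T2 (topspace (subtopology T (?X - Z)) - (Y - Z))"
  proof -
    have "?X - Y = (?X - Z) \<inter> (topspace (subtopology T (?X - Z)) - (Y - Z))" using ZY by auto
    then show ?thesis by (metis glue(4) subtopology_subtopology)
  qed
  ultimately show "?T' \<in> \<Phi>_index T Y"
    using admissible_glue[OF fin ZT adm] D by (simp add: \<Phi>_index_def)
  have "openin (quot_top T ?T') Z"
    using fin ZT top1 top2 by (rule openin_quot_disj_union)
  then show "openin (subtopology (quot_top T ?T') Y) Z"
    using YQ ZY by (simp add: openin_open_subtopology)
qed


section \<open>Linear extensions and tensors of sums\<close>

lemma lin_ext_sum: "lin_ext f (sum g A) = (\<Sum>a\<in>A. lin_ext f (g a))"
  by (induction A rule: infinite_finite_induct) (simp_all add: lin_ext_add, simp_all add: lin_ext_def)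

text \<open>Lets a composite of linear maps be determined by its values on basis vectors.\<close>

lemma lin_ext_lin_ext: "lin_ext f (lin_ext g v) = lin_ext (\<lambda>b. lin_ext f (g b)) v"
  by (simp add: lin_ext_def[of g] lin_ext_def[of "\<lambda>b. lin_ext f (g b)"] lin_ext_sum lin_ext_scale)

lemma lin_ext_cong:
  assumes "v \<in> free_space B" "\<And>b. b \<in> B \<Longrightarrow> f b = g b"
  shows "lin_ext f v = lin_ext g v"
  using assms unfolding lin_ext_def by (intro sum.cong) (auto simp: free_space_def)

lemma tensor_sum_left: "tensor (sum f A) w = (\<Sum>a\<in>A. tensor (f a) w)"
  by (simp add: tensor_def lin_ext_sum)

lemma tensor_basis_sum:
  "tensor (basis_vec b) (\<Sum>a\<in>A. basis_vec (f a)) = (\<Sum>a\<in>A. basis_vec (b, f a))"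
  by (simp add: tensor_def lin_ext_sum)

section \<open>The two composites on basis vectors\<close>

lemma \<Delta>_basis_vec:
  "\<Delta> (basis_vec (T, Y)) = (\<Sum>Z | openin (subtopology T Y) Z.
     basis_vec ((subtopology T Z, Z), (subtopology T (topspace T - Z), Y - Z)))"
  by (simp add: \<Delta>_def)

lemma \<Phi>_basis_vec:
  "\<Phi> (basis_vec (T, Y)) = (\<Sum>T'\<in>\<Phi>_index T Y. basis_vec ((T, T'), (quot_top T T', Y)))"
  by (simp add: \<Phi>_def \<Phi>_index_def)

lemma \<xi>_\<Delta>_\<Phi>_basis_vec:
  "\<xi> (tensor_map id \<Delta> (\<Phi> (basis_vec (T, Y)))) =
    (\<Sum>T'\<in>\<Phi>_index T Y. \<Sum>Z | openin (subtopology (quot_top T T') Y) Z. basis_vec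
      ((disj_union (subtopology T Z) (subtopology T (topspace T - Z)),
        disj_union (subtopology T' Z) (subtopology T' (topspace T - Z))),
       ((subtopology (quot_top T T') Z, Z),
        (subtopology (quot_top T T') (topspace T - Z), Y - Z))))"
  by (simp add: \<Phi>_basis_vec tensor_map_def lin_ext_sum \<Delta>_basis_vec tensor_basis_sum \<xi>_def)

lemma m13_\<Phi>_\<Delta>_basis_vec:
  "m13 (tensor_map \<Phi> \<Phi> (\<Delta> (basis_vec (T, Y)))) =
    (\<Sum>Z | openin (subtopology T Y) Z.
     \<Sum>T1\<in>\<Phi>_index (subtopology T Z) Z.
     \<Sum>T2\<in>\<Phi>_index (subtopology T (topspace T - Z)) (Y - Z). basis_vec
      ((disj_union (subtopology T Z) (subtopology T (topspace T - Z)), disj_union T1 T2),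
       ((quot_top (subtopology T Z) T1, Z),
        (quot_top (subtopology T (topspace T - Z)) T2, Y - Z))))"
  by (simp add: \<Delta>_basis_vec tensor_map_def lin_ext_sum \<Phi>_basis_vec tensor_sum_left
      tensor_basis_sum m13_def)

text \<open>Splitting and gluing are mutually inverse bijections between the pairs
  \<open>(T', Z)\<close> and the triples \<open>(Z, T1, T2)\<close>, and they preserve the
  summands.\<close>

lemma compatibility_basis_vec:
  assumes fin: "finite (topspace T)" and Y: "openin T Y"
  shows "(\<xi> (tensor_map id \<Delta> (\<Phi> (basis_vec (T, Y)))) ::
      ('a topology \<times> 'a topology) \<times> ('a topology \<times> 'a set) \<times> 'a topology \<times> 'a set \<Rightarrow>\<^sub>0 'k::field) =
    m13 (tensor_map \<Phi> \<Phi> (\<Delta> (basis_vec (T, Y))))"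
proof -
  let ?X = "topspace T"
  let ?L = "Sigma (\<Phi>_index T Y) (\<lambda>T'. {Z. openin (subtopology (quot_top T T') Y) Z})"
  let ?R = "Sigma {Z. openin (subtopology T Y) Z}
      (\<lambda>Z. \<Phi>_index (subtopology T Z) Z \<times> \<Phi>_index (subtopology T (?X - Z)) (Y - Z))"
  have finL: "finite {Z. openin (subtopology (quot_top T T') Y) Z}"
    and finR: "finite {Z. openin (subtopology T Y) Z}" for T'
    using fin by (simp_all add: finite_openin)
  have finR': "finite (\<Phi>_index (subtopology T Z) W)" for Z W
    using fin by (simp add: finite_\<Phi>_index)
  show ?thesis
    unfolding \<xi>_\<Delta>_\<Phi>_basis_vec m13_\<Phi>_\<Delta>_basis_vec sum.cartesian_product
    \<comment> \<open>The inner index sets depend on the outer variable, so each nested sum becomes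
      a sum over dependent pairs before reindexing.\<close>
    apply (subst sum.Sigma, use finL finite_\<Phi>_index[OF fin] in simp, use finL in simp)
    apply (subst sum.Sigma, use finR in simp, use finR' in simp)
  proof (rule sum.reindex_bij_witness[where
        i = "\<lambda>(Z, T1, T2). (disj_union T1 T2, Z)" and
        j = "\<lambda>(T', Z). (Z, subtopology T' Z, subtopology T' (?X - Z))"], goal_cases)
    case (1 p)
    then show ?case using \<Phi>_index_split(4)[OF fin] by auto
  next
    case (2 p)
    then show ?case using \<Phi>_index_split(1,5,6)[OF fin] by auto
  next
    case (3 q)
    then show ?case using \<Phi>_index_glue(3,4)[OF fin Y] by auto
  next
    case (4 q)
    then show ?case using \<Phi>_index_glue(1,2)[OF fin Y] by auto
  next
    \<comment> \<open>Equality of matched summands. Since \<open>\<xi>\<close> has already cut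
      \<open>T\<close> and \<open>T'\<close> along \<open>Z\<close>, the first factors coincide as
      they stand; only the quotients need comparing. \<open>T\<close> itself may have relations
      across \<open>Z\<close>, which the product on the right side lacks.\<close>
    case (5 p)
    then obtain T' Z where p: "p = (T', Z)"
      and "T' \<in> \<Phi>_index T Y" "openin (subtopology (quot_top T T') Y) Z" by auto
    then show ?case
      using \<Phi>_index_split(2,3)[OF fin, of T' Y Z] by (simp add: quot_subtopology_open fin)
  qed
qed

theorem theorem5p1:
  fixes X :: "'a set"
  assumes "finite X"
  shows "\<forall>v \<in> (free_space (D_basis X) :: ('a topology \<times> 'a set \<Rightarrow>\<^sub>0 'k::field) set).
    (\<xi> \<circ> tensor_map id \<Delta> \<circ> \<Phi>) v = (m13 \<circ> tensor_map \<Phi> \<Phi> \<circ> \<Delta>) v"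
proof
  fix v :: "'a topology \<times> 'a set \<Rightarrow>\<^sub>0 'k"
  assume v: "v \<in> free_space (D_basis X)"
  \<comment> \<open>Each composite is the linear extension of its values on basis vectors, so it
    suffices to compare these for pairs in \<open>D_basis X\<close>, where finiteness and openness
    are available.\<close>
  have L: "\<xi> (tensor_map id \<Delta> (\<Phi> v)) =
      lin_ext (\<lambda>b. \<xi> (tensor_map id \<Delta> (\<Phi> (basis_vec b)))) v"
    by (simp add: \<xi>_def tensor_map_def \<Phi>_def lin_ext_lin_ext)
  have R: "m13 (tensor_map \<Phi> \<Phi> (\<Delta> v)) =
      lin_ext (\<lambda>b. m13 (tensor_map \<Phi> \<Phi> (\<Delta> (basis_vec b)))) v"
    by (simp add: m13_def tensor_map_def \<Delta>_def lin_ext_lin_ext)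
  have "lin_ext (\<lambda>b. \<xi> (tensor_map id \<Delta> (\<Phi> (basis_vec b)))) v =
      lin_ext (\<lambda>b. m13 (tensor_map \<Phi> \<Phi> (\<Delta> (basis_vec b)))) v"
    using v
  proof (rule lin_ext_cong)
    fix b :: "'a topology \<times> 'a set" assume "b \<in> D_basis X"
    then show "\<xi> (tensor_map id \<Delta> (\<Phi> (basis_vec b))) =
        (m13 (tensor_map \<Phi> \<Phi> (\<Delta> (basis_vec b))) :: _ \<Rightarrow>\<^sub>0 'k)"
      using assms compatibility_basis_vec by (auto simp: D_basis_def)
  qed
  then show "(\<xi> \<circ> tensor_map id \<Delta> \<circ> \<Phi>) v = (m13 \<circ> tensor_map \<Phi> \<Phi> \<circ> \<Delta>) v"
    by (simp add: L R)
qed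

end
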